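(* Let $G$ be a finite group with center $Z(G)$. If $G/Z(G) \cong \mathbb{Z}_p\times\mathbb{Z}_p$ for some prime $p$, then $E(\Gamma_{nc}(G)) \leq LE(\Gamma_{nc}(G))$.
   Context: For a finite non-abelian group $G$ with center $Z(G)$, the non-commuting graph $\Gamma_{nc}(G)$ is the simple undirected graph with vertex set $G\setminus Z(G)$, in which two vertices $x,y$ are adjacent if and only if $xy \ne yx$. For a finite simple graph $\mathcal{G}$ with vertex set $v(\mathcal{G})$ and edge set $e(\mathcal{G})$, the energy $E(\mathcal{G})$ is the sum of $|\lambda|$ over the eigenvalues $\lambda$ of the adjacency matrix $\mathcal{A}(\mathcal{G})$, and the Laplacian energy is $LE(\mathcal{G}) = \sum_{\mu}\left|\mu - \frac{2|e(\mathcal{G})|}{|v(\mathcal{G})|}\right|$, the sum over the eigenvalues $\mu$ of the Laplacian matrix $L(\mathcal{G}) = D(\mathcal{G}) - \mathcal{A}(\mathcal{G})$, where $D(\mathcal{G})$ is the diagonal degree matrix; eigenvalues are counted with multiplicity. *)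

theory Defs
  imports
    "HOL-Algebra.Elementary_Groups"
    "HOL-Algebra.Coset"
    "HOL-Library.Countable_Set"
    "HOL-Computational_Algebra.Primes"
    "Jordan_Normal_Form.Spectral_Radius"
begin

section \<open>Finite simple graphs\<close>

record 'a sgraph =
  gverts :: "'a set"
  gedges :: "'a set set"

definition finite_simple_graph :: "'a sgraph \<Rightarrow> bool" where
  "finite_simple_graph \<G> \<longleftrightarrow>
     finite (gverts \<G>) \<and> (\<forall>e \<in> gedges \<G>. e \<subseteq> gverts \<G> \<and> card e = 2)"

definition vdegree :: "'a sgraph \<Rightarrow> 'a \<Rightarrow> nat" where
  "vdegree \<G> v = card {e \<in> gedges \<G>. v \<in> e}"

text \<open>
  Rows and columns are indexed by the vertices through the enumeration
  \<^term>\<open>from_nat_into (gverts \<G>)\<close>, a bijection from \<^term>\<open>{..<card (gverts \<G>)}\<close> onto the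
  vertex set when the latter is finite. Another enumeration would conjugate all the matrices below
  by the same permutation matrix, so the eigenvalues and their multiplicities do not depend on it.
  The entries are taken in \<^typ>\<open>complex\<close> so that no eigenvalue is lost by definition.
\<close>

definition adjacency_matrix :: "'a sgraph \<Rightarrow> complex mat" where
  "adjacency_matrix \<G> = mat (card (gverts \<G>)) (card (gverts \<G>))
     (\<lambda>(i, j). if {from_nat_into (gverts \<G>) i, from_nat_into (gverts \<G>) j} \<in> gedges \<G>
               then 1 else 0)"

definition degree_matrix :: "'a sgraph \<Rightarrow> complex mat" where
  "degree_matrix \<G> = mat (card (gverts \<G>)) (card (gverts \<G>))
     (\<lambda>(i, j). if i = j then of_nat (vdegree \<G> (from_nat_into (gverts \<G>) i)) else 0)"

definition laplacian_matrix :: "'a sgraph \<Rightarrow> complex mat" where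
  "laplacian_matrix \<G> = degree_matrix \<G> - adjacency_matrix \<G>"

text \<open>The sum of \<^term>\<open>f k\<close> over the eigenvalues \<^term>\<open>k\<close> of \<^term>\<open>A\<close>, each one repeated
  according to its algebraic multiplicity.\<close>

definition eigenvalue_sum :: "(complex \<Rightarrow> real) \<Rightarrow> complex mat \<Rightarrow> real" where
  "eigenvalue_sum f A = (\<Sum>k \<in> spectrum A. real (order k (char_poly A)) * f k)"

definition energy :: "'a sgraph \<Rightarrow> real" where
  "energy \<G> = eigenvalue_sum (\<lambda>k. cmod k) (adjacency_matrix \<G>)"

definition laplacian_energy :: "'a sgraph \<Rightarrow> real" where
  "laplacian_energy \<G> =
     eigenvalue_sum
       (\<lambda>k. cmod (k - of_real (2 * real (card (gedges \<G>)) / real (card (gverts \<G>)))))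
       (laplacian_matrix \<G>)"

section \<open>The non-commuting graph of a group\<close>

definition group_center :: "('a, 'b) monoid_scheme \<Rightarrow> 'a set" where
  "group_center G = {z \<in> carrier G. \<forall>x \<in> carrier G. z \<otimes>\<^bsub>G\<^esub> x = x \<otimes>\<^bsub>G\<^esub> z}"

definition nc_graph :: "('a, 'b) monoid_scheme \<Rightarrow> 'a sgraph" where
  "nc_graph G =
     \<lparr> gverts = carrier G - group_center G,
       gedges = {{x, y} | x y. x \<in> carrier G - group_center G \<and> y \<in> carrier G - group_center G
                               \<and> x \<otimes>\<^bsub>G\<^esub> y \<noteq> y \<otimes>\<^bsub>G\<^esub> x} \<rparr>"

lemma finite_simple_graph_nc_graph:
  assumes "finite (carrier G)"
  shows "finite_simple_graph (nc_graph G)"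
  using assms by (force simp: finite_simple_graph_def nc_graph_def card_2_iff)

end

theory Submission
  imports Defs
begin

text \<open>
  The inequality is in fact an equality, and no eigenvalue has to be computed for it.

  In a \<open>d\<close>-regular graph the Laplacian matrix is \<open>d I - A\<close>, so its eigenvalues are the numbers
  \<open>d - k\<close>, where \<open>k\<close> runs through the eigenvalues of the adjacency matrix \<open>A\<close> with the same
  multiplicities. The mean degree \<open>2 |e| / |v|\<close> is \<open>d\<close>, so each eigenvalue contributes
  \<open>|(d - k) - d| = |k|\<close> to the Laplacian energy; this is \<open>laplacian_energy_regular\<close>.

  It remains to see that the non-commuting graph is regular. A non-central \<open>x\<close> is adjacent to
  exactly the elements outside its centralizer \<open>C(x)\<close>. Since \<open>x\<close> is a non-central element of \<open>C(x)\<close>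
  and does not commute with everything, \<open>Z(G) < C(x) < G\<close> with both inclusions strict. As
  \<open>[G : Z(G)] = p\<^sup>2\<close>, both indices equal \<open>p\<close>, hence \<open>|C(x)| = p |Z(G)|\<close> whatever \<open>x\<close> is
  (\<open>card_centralizer\<close>).
\<close>

section \<open>Eigenvalues of a scalar matrix minus a matrix\<close>

lemma pcompose_power:
  fixes q r :: "'a :: comm_semiring_1 poly"
  shows "pcompose (q ^ n) r = pcompose q r ^ n"
  by (induction n) (simp_all add: pcompose_1 pcompose_mult)

text \<open>Substituting \<open>c - X\<close> for \<open>X\<close> turns each factor \<open>X - a\<close> of \<^term>\<open>q\<close> into the
  associate \<open>-(X - (c - a))\<close>, and the cofactor still does not vanish at the reflected point.\<close>

lemma order_pcompose_reflect:
  fixes q :: "'a :: field poly"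
  assumes "q \<noteq> 0"
  shows "Polynomial.order (c - a) (pcompose q [:c, -1:]) = Polynomial.order a q"
proof -
  obtain r where q: "q = [:- a, 1:] ^ Polynomial.order a q * r" and r: "\<not> [:- a, 1:] dvd r"
    using order_decomp[OF assms] by blast
  have "poly r a \<noteq> 0"
    using r by (simp add: poly_eq_0_iff_dvd)
  then have order_r: "Polynomial.order (c - a) (pcompose r [:c, -1:]) = 0"
    by (intro order_0I) (simp add: poly_pcompose)
  have "pcompose q [:c, -1:]
      = pcompose [:- a, 1:] [:c, -1:] ^ Polynomial.order a q * pcompose r [:c, -1:]"
    by (subst q) (simp add: pcompose_mult pcompose_power)
  also have "pcompose [:- a, 1:] [:c, -1:] = Polynomial.smult (- 1) [:- (c - a), 1:]"
    by (simp add: pcompose_pCons)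
  finally have eq: "pcompose q [:c, -1:] = Polynomial.smult ((- 1) ^ Polynomial.order a q)
      ([:- (c - a), 1:] ^ Polynomial.order a q * pcompose r [:c, -1:])"
    by (simp only: smult_power mult_smult_left)
  have "r \<noteq> 0"
    using r by auto
  then have "pcompose r [:c, -1:] \<noteq> 0"
    by (simp add: pcompose_eq_0_iff)
  then have nonzero: "[:- (c - a), 1:] ^ Polynomial.order a q * pcompose r [:c, -1:] \<noteq> 0"
    by (metis mult_eq_0_iff power_eq_0_iff pCons_eq_0_iff one_neq_zero)
  have "(- 1 :: 'a) ^ Polynomial.order a q \<noteq> 0"
    by (metis power_not_zero neg_equal_0_iff_equal one_neq_zero)
  then have "Polynomial.order (c - a) (pcompose q [:c, -1:])
      = Polynomial.order (c - a) ([:- (c - a), 1:] ^ Polynomial.order a q * pcompose r [:c, -1:])"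
    unfolding eq by (rule order_smult)
  also have "\<dots> = Polynomial.order a q"
    by (simp only: order_mult[OF nonzero] order_power_n_n order_r add_0_right)
  finally show ?thesis .
qed

text \<open>
  At every point \<open>k\<close>, \<open>k I - (c I - A) = -((c - k) I - A)\<close>, and the sign leaves the determinant as
  \<open>(-1)\<^sup>n\<close>.
\<close>

lemma char_poly_scalar_minus:
  fixes A :: "'a :: field_char_0 mat"
  assumes A: "A \<in> carrier_mat n n"
  shows "char_poly (c \<cdot>\<^sub>m 1\<^sub>m n - A) = Polynomial.smult ((- 1) ^ n) (pcompose (char_poly A) [:c, -1:])"
proof -
  have B: "c \<cdot>\<^sub>m 1\<^sub>m n - A \<in> carrier_mat n n"
    using A by auto
  have "poly (char_poly (c \<cdot>\<^sub>m 1\<^sub>m n - A)) k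
      = poly (Polynomial.smult ((- 1) ^ n) (pcompose (char_poly A) [:c, -1:])) k" for k
  proof -
    (* char_matrix M k is M - k I, hence the outer minus signs. *)
    have "- char_matrix (c \<cdot>\<^sub>m 1\<^sub>m n - A) k = (- 1) \<cdot>\<^sub>m (- char_matrix A (c - k))"
      using A by (intro eq_matI) (auto simp: char_matrix_def)
    moreover have "dim_col (char_matrix A (c - k)) = n"
      using A by (simp add: char_matrix_def)
    ultimately show ?thesis
      by (simp add: char_poly_matrix[OF A] char_poly_matrix[OF B] poly_pcompose)
  qed
  then show ?thesis
    by (simp add: poly_eq_poly_eq_iff[symmetric] fun_eq_iff)
qed

lemma eigenvalue_sum_scalar_minus:
  assumes A: "A \<in> carrier_mat n n"
  shows "eigenvalue_sum f (c \<cdot>\<^sub>m 1\<^sub>m n - A) = eigenvalue_sum (\<lambda>k. f (c - k)) A"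
proof -
  have B: "c \<cdot>\<^sub>m 1\<^sub>m n - A \<in> carrier_mat n n"
    using A by auto
  have "char_poly A \<noteq> 0"
    using degree_monic_char_poly[OF A] by auto
  then have order_eq: "Polynomial.order (c - k) (char_poly (c \<cdot>\<^sub>m 1\<^sub>m n - A))
      = Polynomial.order k (char_poly A)" for k
    by (simp add: char_poly_scalar_minus[OF A] order_smult order_pcompose_reflect)
  have spectrum_iff: "c - k \<in> spectrum (c \<cdot>\<^sub>m 1\<^sub>m n - A) \<longleftrightarrow> k \<in> spectrum A" for k
    by (simp add: spectrum_root_char_poly[OF A] spectrum_root_char_poly[OF B]
        char_poly_scalar_minus[OF A] poly_pcompose)
  show ?thesis
    unfolding eigenvalue_sum_def
    by (rule sum.reindex_bij_witness[where i = "\<lambda>k. c - k" and j = "\<lambda>k. c - k"])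
      (use spectrum_iff[of "c - _"] spectrum_iff order_eq[of "c - _"] in auto)
qed

section \<open>Energies of a regular graph\<close>

text \<open>The handshake lemma: count the incident pairs of a vertex and an edge in two ways.\<close>

lemma sum_vdegree:
  assumes "finite_simple_graph \<G>"
  shows "(\<Sum>v\<in>gverts \<G>. vdegree \<G> v) = 2 * card (gedges \<G>)"
proof -
  have V: "finite (gverts \<G>)" and E: "\<And>e. e \<in> gedges \<G> \<Longrightarrow> e \<subseteq> gverts \<G> \<and> card e = 2"
    using assms by (auto simp: finite_simple_graph_def)
  have "finite (gedges \<G>)"
    by (rule finite_subset[of _ "Pow (gverts \<G>)"]) (use V E in auto)
  moreover have "card {v \<in> gverts \<G>. v \<in> e} = 2" if "e \<in> gedges \<G>" for e
  proof -
    have "{v \<in> gverts \<G>. v \<in> e} = e"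
      using E[OF that] by auto
    then show ?thesis
      using E[OF that] by simp
  qed
  ultimately show ?thesis
    unfolding vdegree_def using V by (intro sum_multicount) auto
qed

text \<open>
  The mean degree is \<open>d\<close>, and shifting the spectrum of \<open>L = d I - A\<close> back by it leaves the
  eigenvalues \<open>-k\<close>, of the same modulus as the eigenvalues \<open>k\<close> of \<open>A\<close>.
  Nonemptiness makes the quotient \<open>2 |e| / |v|\<close> an honest mean degree.
\<close>

lemma laplacian_energy_regular:
  assumes graph: "finite_simple_graph \<G>" and "gverts \<G> \<noteq> {}"
    and regular: "\<And>v. v \<in> gverts \<G> \<Longrightarrow> vdegree \<G> v = d"
  shows "laplacian_energy \<G> = energy \<G>"
proof -
  define n where "n = card (gverts \<G>)"
  have V: "finite (gverts \<G>)"
    using graph by (simp add: finite_simple_graph_def)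
  have n: "n > 0"
    using V assms(2) by (simp add: n_def card_gt_0_iff)
  have "2 * card (gedges \<G>) = n * d"
    using sum_vdegree[OF graph] regular by (simp add: n_def)
  then have "2 * real (card (gedges \<G>)) = real n * real d"
    by (metis of_nat_mult of_nat_numeral)
  then have mean: "2 * real (card (gedges \<G>)) / real (card (gverts \<G>)) = real d"
    using n by (simp add: n_def)
  have A: "adjacency_matrix \<G> \<in> carrier_mat n n"
    by (simp add: adjacency_matrix_def n_def)
  have "degree_matrix \<G> = of_nat d \<cdot>\<^sub>m 1\<^sub>m n"
    using regular assms(2) by (intro eq_matI) (auto simp: degree_matrix_def n_def from_nat_into)
  then show ?thesis
    unfolding laplacian_energy_def energy_def laplacian_matrix_def mean
    by (simp add: eigenvalue_sum_scalar_minus[OF A])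
qed

section \<open>Centralizers when the center has index \<open>p\<^sup>2\<close>\<close>

lemma prime_square_factor:
  fixes p k l :: nat
  assumes "Factorial_Ring.prime p" "p\<^sup>2 = l * k" "k \<noteq> 1" "l \<noteq> 1"
  shows "k = p"
proof -
  have "k dvd p\<^sup>2"
    by (simp add: assms(2))
  then obtain i where i: "i \<le> 2" "k = p ^ i"
    using divides_primepow_nat[OF assms(1)] by blast
  have "i \<noteq> 0"
    using i assms(3) by (intro notI) simp
  moreover have "i \<noteq> 2"
    using i assms(2,4) prime_gt_0_nat[OF assms(1)] by (intro notI) simp
  ultimately have "i = 1"
    using i(1) by simp
  then show ?thesis
    using i(2) by simp
qed

definition centralizer :: "('a, 'b) monoid_scheme \<Rightarrow> 'a \<Rightarrow> 'a set" where
  "centralizer G x = {y \<in> carrier G. x \<otimes>\<^bsub>G\<^esub> y = y \<otimes>\<^bsub>G\<^esub> x}"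

context group
begin

lemma inv_commute:
  assumes "x \<in> carrier G" "y \<in> carrier G" "x \<otimes> y = y \<otimes> x"
  shows "x \<otimes> inv y = inv y \<otimes> x"
  by (metis assms inv_closed inv_solve_left m_assoc inv_solve_right m_closed)

lemma subgroup_centralizer:
  assumes x: "x \<in> carrier G"
  shows "subgroup (centralizer G x) G"
proof (rule subgroupI)
  show "centralizer G x \<noteq> {}"
    using x by (auto simp: centralizer_def)
  show "a \<otimes> b \<in> centralizer G x" if "a \<in> centralizer G x" "b \<in> centralizer G x" for a b
    using that x by (simp add: centralizer_def) (metis m_assoc)
qed (use x inv_commute in \<open>auto simp: centralizer_def\<close>)

lemma subgroup_group_center: "subgroup (group_center G) G"
proof -
  have "group_center G = (\<Inter>x\<in>carrier G. centralizer G x)"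
    by (auto simp: group_center_def centralizer_def)
  moreover have "subgroup (\<Inter>x\<in>carrier G. centralizer G x) G"
    by (rule subgroups_Inter) (auto intro: subgroup_centralizer)
  ultimately show ?thesis
    by simp
qed

text \<open>
  By Lagrange's theorem \<open>p\<^sup>2 = [G : C(x)] [C(x) : Z(G)]\<close>, and neither factor is \<open>1\<close>, because \<open>x\<close> lies
  in \<open>C(x)\<close> but not in \<open>Z(G)\<close>, and some element of \<open>G\<close> does not commute with \<open>x\<close>.
\<close>

lemma card_centralizer:
  assumes "finite (carrier G)" "Factorial_Ring.prime p"
    and index: "card (carrier (G Mod group_center G)) = p\<^sup>2"
    and x: "x \<in> carrier G - group_center G"
  shows "card (centralizer G x) = p * card (group_center G)"
proof -
  let ?Z = "group_center G" and ?C = "centralizer G x"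
  have Z: "subgroup ?Z G"
    by (rule subgroup_group_center)
  have C: "subgroup ?C G"
    using x by (simp add: subgroup_centralizer)
  interpret C: group "G\<lparr>carrier := ?C\<rparr>"
    using C by (rule subgroup_imp_group)
  have ZC: "?Z \<subset> ?C"
    using x by (auto simp: group_center_def centralizer_def)
  have CG: "?C \<subset> carrier G"
    using x by (fastforce simp: group_center_def centralizer_def)
  have "subgroup ?Z (G\<lparr>carrier := ?C\<rparr>)"
    using Z C ZC by (intro subgroup_incl) auto
  from C.lagrange[OF this] obtain k where k: "k * card ?Z = card ?C"
    by (auto simp: Coset.order_def)
  from lagrange[OF C] obtain l where l: "l * card ?C = card (carrier G)"
    by (auto simp: Coset.order_def)
  have "p\<^sup>2 * card ?Z = card (carrier G)"
    using lagrange[OF Z] index by (simp add: Coset.order_def FactGroup_def)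
  then have "p\<^sup>2 * card ?Z = l * k * card ?Z"
    using k l by (simp add: mult.assoc)
  moreover have "card ?Z > 0"
    using Z assms(1) by (metis subgroup.finite_imp_card_positive)
  ultimately have "p\<^sup>2 = l * k"
    by simp
  moreover have "k \<noteq> 1"
    using k psubset_card_mono[OF _ ZC] CG assms(1) finite_subset by fastforce
  moreover have "l \<noteq> 1"
    using l psubset_card_mono[OF assms(1) CG] by auto
  ultimately have "k = p"
    by (rule prime_square_factor[OF assms(2)])
  then show ?thesis
    using k by simp
qed

text \<open>
  The edges at \<open>x\<close> correspond to the elements that do not commute with \<open>x\<close>; all of these are
  non-central, so the removal of the center from the vertex set loses none of them.
\<close>

lemma vdegree_nc_graph:
  assumes "finite (carrier G)" and x: "x \<in> carrier G - group_center G"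
  shows "vdegree (nc_graph G) x = card (carrier G) - card (centralizer G x)"
proof -
  have "{e \<in> gedges (nc_graph G). x \<in> e} = (\<lambda>y. {x, y}) ` (carrier G - centralizer G x)"
    using x by (auto simp: nc_graph_def centralizer_def group_center_def insert_commute) metis+
  moreover have "inj_on (\<lambda>y. {x, y}) (carrier G - centralizer G x)"
    by (auto simp: inj_on_def doubleton_eq_iff)
  ultimately have "vdegree (nc_graph G) x = card (carrier G - centralizer G x)"
    by (simp add: vdegree_def card_image)
  also have "\<dots> = card (carrier G) - card (centralizer G x)"
    using assms by (intro card_Diff_subset) (auto simp: centralizer_def)
  finally show ?thesis .
qed

end

text \<open>All non-central elements have the degree \<open>|G| - p |Z(G)|\<close>, so the two energies agree.\<close>

theorem theorem4p7:
  fixes G (structure) and p :: nat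
  assumes "group G"
    and "finite (carrier G)"
    and "prime p"
    and "G Mod group_center G \<cong> integer_mod_group p \<times>\<times> integer_mod_group p"
  shows "energy (nc_graph G) \<le> laplacian_energy (nc_graph G)"
proof -
  interpret group G
    by fact
  have index: "card (carrier (G Mod group_center G)) = p\<^sup>2"
    using iso_same_card[OF assms(4)] prime_gt_0_nat[OF assms(3)]
    by (simp add: carrier_integer_mod_group card_cartesian_product power2_eq_square)
  (* An abelian G would have a central quotient of order 1, so there is at least one vertex. *)
  have "carrier G \<noteq> group_center G"
  proof
    assume "carrier G = group_center G"
    then have "card (carrier (G Mod carrier G)) = p\<^sup>2"
      using index by simp
    then show False
      using assms(3) lagrange[OF subgroup_self] assms(2)
      by (auto simp: FactGroup_def Coset.order_def)
  qed
  moreover have V: "gverts (nc_graph G) = carrier G - group_center G"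
    by (simp add: nc_graph_def)
  ultimately have "gverts (nc_graph G) \<noteq> {}"
    by (auto simp: group_center_def)
  then have "laplacian_energy (nc_graph G) = energy (nc_graph G)"
    by (rule laplacian_energy_regular[OF finite_simple_graph_nc_graph[OF assms(2)],
          where d = "card (carrier G) - p * card (group_center G)"])
      (simp add: V vdegree_nc_graph card_centralizer[OF assms(2,3) index] assms(2))
  then show ?thesis
    by simp
qed

end
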